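(* Let $L\subseteq E$ be a linear subspace. If $\|\cdot\|=\|\cdot\|_2$ then $$\nu(L)=\sin\angle(L^\perp,K^* ).$$
   Context: $E$ is a finite-dimensional real vector space with inner product $\langle\cdot,\cdot\rangle$, endowed with a norm $\|\cdot\|$; the dual norm is $\|u\|^*:=\max_{\|x\|=1}\langle u,x\rangle$. $\|v\|_2:=\sqrt{\langle v,v\rangle}$ is the Euclidean norm (its dual norm is $\|\cdot\|_2$ itself). $K\subseteq E$ is a regular closed convex cone ($\operatorname{int}(K)\neq\emptyset$ and $K$ contains no lines), with dual cone $K^*:=\{u\in E:\langle u,x\rangle\ge 0\ \forall x\in K\}$. For a linear subspace $L\subseteq E$ with orthogonal complement $L^\perp$, $$\nu(L):=\min_{u\in K^*,\,y\in L^\perp,\,\|u\|^*=1}\|u-y\|^*.$$ For $x,y\in E\setminus\{0\}$, $\angle(x,y):=\arccos\frac{\langle x,y\rangle}{\|x\|_2\|y\|_2}\in[0,\pi]$. For a linear subspace $M\subseteq E$ and a closed convex cone $C\subseteq E$, $$\angle(M,C):=\min\{\angle(x,v): x\in M\setminus\{0\},\ v\in C\setminus\{0\}\}\in[0,\pi/2].$$ *)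

theory Defs
  imports "HOL-Analysis.Analysis"
begin

(* The type class constant norm is the Euclidean norm sqrt (v \<bullet> v) of the inner
   product (norm_eq_sqrt_inner); an arbitrary norm on the space is a function N. *)

definition is_norm :: "('a::real_vector \<Rightarrow> real) \<Rightarrow> bool" where
  "is_norm N \<longleftrightarrow>
     (\<forall>x. 0 \<le> N x) \<and>
     (\<forall>x. N x = 0 \<longleftrightarrow> x = 0) \<and>
     (\<forall>c x. N (c *\<^sub>R x) = \<bar>c\<bar> * N x) \<and>
     (\<forall>x y. N (x + y) \<le> N x + N y)"

(* Maxima and minima over infinite sets are rendered by GREATEST and LEAST rather
   than Sup and Inf: these denote the extremal element only when it is attained. *)

definition dual_norm :: "('a::euclidean_space \<Rightarrow> real) \<Rightarrow> 'a \<Rightarrow> real" where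
  "dual_norm N u = (GREATEST r. \<exists>x. N x = 1 \<and> r = u \<bullet> x)"

definition contains_no_lines :: "'a::real_vector set \<Rightarrow> bool" where
  "contains_no_lines S \<longleftrightarrow> \<not> (\<exists>a d. d \<noteq> 0 \<and> (\<forall>t::real. a + t *\<^sub>R d \<in> S))"

definition regular_cone :: "'a::euclidean_space set \<Rightarrow> bool" where
  "regular_cone K \<longleftrightarrow>
     closed K \<and> convex_cone K \<and> interior K \<noteq> {} \<and> contains_no_lines K"

definition dual_cone :: "'a::real_inner set \<Rightarrow> 'a set" where
  "dual_cone K = {u. \<forall>x\<in>K. 0 \<le> u \<bullet> x}"

definition nu :: "('a::euclidean_space \<Rightarrow> real) \<Rightarrow> 'a set \<Rightarrow> 'a set \<Rightarrow> real" where
  "nu N K L =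
     (LEAST r. \<exists>u y. u \<in> dual_cone K \<and> y \<in> L\<^sup>\<bottom> \<and> dual_norm N u = 1 \<and>
                     r = dual_norm N (u - y))"

definition vec_angle :: "'a::real_inner \<Rightarrow> 'a \<Rightarrow> real" where
  "vec_angle x y = arccos ((x \<bullet> y) / (norm x * norm y))"

(* If M or C is {0}, there are no pairs to minimise over; the angle is then taken to be
   pi / 2, the largest value an angle between a subspace and a cone can have. *)

definition angle_subspace_cone :: "'a::real_inner set \<Rightarrow> 'a set \<Rightarrow> real" where
  "angle_subspace_cone M C =
     (if M = {0} \<or> C = {0} then pi / 2
      else (LEAST \<theta>. \<exists>x v. x \<in> M - {0} \<and> v \<in> C - {0} \<and> \<theta> = vec_angle x v))"

end

theory Submission
  imports Defs
begin

text \<open>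
  If \<open>x\<close> and \<open>v\<close> are unit vectors of \<open>M = L\<^sup>\<bottom>\<close> and \<open>K\<^sup>*\<close> with the largest possible inner
  product \<open>c\<close>, then \<open>arccos c\<close> is the angle, and \<open>c \<ge> 0\<close> because \<open>M = - M\<close>. For a unit \<open>u \<in> K\<^sup>*\<close>
  and any \<open>y \<in> M\<close> we have \<open>u \<bullet> y \<le> c * norm y\<close>, hence
  \<open>(norm (u - y))\<^sup>2 \<ge> 1 - 2 * c * norm y + (norm y)\<^sup>2 \<ge> 1 - c\<^sup>2\<close>,
  with equality at \<open>u = v\<close>, \<open>y = c *\<^sub>R x\<close>.
\<close>

text \<open>Cauchy-Schwarz gives the upper bound. It is attained at \<open>sgn u\<close>, or at an
  arbitrary unit vector if \<open>u = 0\<close>, as \<open>GREATEST\<close> requires.\<close>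

lemma dual_norm_norm: "dual_norm norm u = norm (u::'a::euclidean_space)"
  unfolding dual_norm_def
proof (rule Greatest_equality)
  show "\<exists>x. norm x = 1 \<and> norm u = u \<bullet> x"
  proof (cases "u = 0")
    case True
    then show ?thesis
      by (metis inner_zero_left norm_zero vector_choose_size zero_le_one)
  next
    case False
    then show ?thesis
      by (intro exI[of _ "sgn u"])
        (simp add: norm_sgn sgn_div_norm dot_square_norm power2_eq_square)
  qed
  show "r \<le> norm u" if "\<exists>x. norm x = 1 \<and> r = u \<bullet> x" for r
    using that norm_cauchy_schwarz[of u] by (metis mult.right_neutral)
qed

lemma closed_dual_cone: "closed (dual_cone K)"
proof -
  have "dual_cone K = (\<Inter>x\<in>K. {u. x \<bullet> u \<ge> 0})"
    by (auto simp: dual_cone_def inner_commute)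
  then show ?thesis
    by (simp add: closed_INT closed_halfspace_ge)
qed

lemma scaleR_in_dual_cone: "u \<in> dual_cone K \<Longrightarrow> 0 \<le> c \<Longrightarrow> c *\<^sub>R u \<in> dual_cone K"
  by (simp add: dual_cone_def)

text \<open>A point outside \<open>K\<close> can be strictly separated from \<open>K\<close> by a
  hyperplane. On a cone, a linear functional that is bounded below is nonnegative, so the normal of
  the hyperplane lies in the dual cone.\<close>

lemma dual_cone_nontrivial:
  fixes K :: "'a::euclidean_space set"
  assumes "closed K" "convex_cone K" "K \<noteq> UNIV"
  shows "\<exists>u\<in>dual_cone K. u \<noteq> 0"
proof -
  obtain z where z: "z \<notin> K"
    using assms by blast
  have "convex K" and K: "0 \<in> K" "\<And>x c. x \<in> K \<Longrightarrow> 0 \<le> c \<Longrightarrow> c *\<^sub>R x \<in> K"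
    using assms(2) by (auto simp: convex_cone_contains_0 convex_cone_def conic_mul)
  then obtain a b where ab: "a \<bullet> z < b" "\<And>x. x \<in> K \<Longrightarrow> b < a \<bullet> x"
    using separating_hyperplane_closed_point[of K z] assms z by blast
  have "b < 0"
    using ab(2)[OF K(1)] by simp
  have "0 \<le> a \<bullet> x" if "x \<in> K" for x
  proof (rule ccontr)
    assume neg: "\<not> 0 \<le> a \<bullet> x"
    \<comment> \<open>Both \<open>b\<close> and \<open>a \<bullet> x\<close> are negative, so the
      factor is positive and the scaled point stays in \<open>K\<close>. The functional takes the
      value \<open>b\<close> there, against strict separation.\<close>
    have "b < a \<bullet> ((b / (a \<bullet> x)) *\<^sub>R x)"
      using neg \<open>b < 0\<close> that by (intro ab(2) K(2)) (auto simp: divide_nonpos_nonpos)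
    then show False
      using neg by simp
  qed
  moreover have "a \<noteq> 0"
    using ab(1) \<open>b < 0\<close> by auto
  ultimately show ?thesis
    by (auto simp: dual_cone_def)
qed

text \<open>A Euclidean space has a nonzero vector, hence contains a line, so a cone without lines
  is a proper subset. The unit vector obtained makes the minimum in \<open>nu\<close> range over a
  nonempty set and rules out the default angle on the side of the dual cone.\<close>

lemma regular_cone_dual_nontrivial:
  fixes K :: "'a::euclidean_space set"
  assumes "regular_cone K"
  shows "\<exists>u\<in>dual_cone K. norm u = 1"
proof -
  obtain d :: 'a where "norm d = 1"
    by (metis vector_choose_size zero_le_one)
  then have "d \<noteq> 0"
    by auto
  then have "K \<noteq> UNIV"
    using assms by (auto simp: regular_cone_def contains_no_lines_def)
  then obtain u where "u \<in> dual_cone K" "u \<noteq> 0"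
    using dual_cone_nontrivial assms by (auto simp: regular_cone_def)
  then show ?thesis
    by (intro bexI[of _ "inverse (norm u) *\<^sub>R u"]) (auto intro: scaleR_in_dual_cone)
qed

text \<open>Only \<open>y = 0\<close> is admissible here, so every candidate value is 1. This
  matches the sine of the default angle \<open>pi / 2\<close>.\<close>

lemma nu_norm_trivial:
  fixes K :: "'a::euclidean_space set"
  assumes "L\<^sup>\<bottom> = {0}" "u \<in> dual_cone K" "norm u = 1"
  shows "nu norm K L = 1"
  unfolding nu_def dual_norm_norm assms(1)
proof (rule Least_equality)
  show "\<exists>u y. u \<in> dual_cone K \<and> y \<in> {0} \<and> norm u = 1 \<and> 1 = norm (u - y)"
    using assms(2,3) by (intro exI[of _ u] exI[of _ 0]) simp
qed force

text \<open>The unit vectors of \<open>M\<close> and of \<open>C\<close> form compact sets, so the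
  inner product attains its maximum on their product. Homogeneity carries the bound over to vectors
  of any length.\<close>

lemma maximal_unit_inner:
  fixes M C :: "'a::euclidean_space set"
  assumes M: "subspace M" "M \<noteq> {0}"
    and C: "closed C" "\<And>v c. v \<in> C \<Longrightarrow> 0 \<le> c \<Longrightarrow> c *\<^sub>R v \<in> C" "\<exists>v\<in>C. norm v = 1"
  shows "\<exists>x\<in>M. \<exists>v\<in>C. norm x = 1 \<and> norm v = 1 \<and> 0 \<le> x \<bullet> v \<and>
    (\<forall>y\<in>M. \<forall>u\<in>C. y \<bullet> u \<le> (x \<bullet> v) * (norm y * norm u))"
proof -
  define S where "S = (M \<inter> sphere 0 1) \<times> (C \<inter> sphere 0 1)"
  have "compact S"
    unfolding S_def using M C
    by (intro compact_Times closed_Int_compact) (auto simp: closed_subspace)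
  obtain y where y: "y \<in> M" "y \<noteq> 0"
    using M subspace_0 by blast
  then have "inverse (norm y) *\<^sub>R y \<in> M \<inter> sphere 0 1"
    using M by (auto simp: subspace_scale)
  then have "S \<noteq> {}"
    using C(3) by (auto simp: S_def)
  have "continuous_on S (\<lambda>p. fst p \<bullet> snd p)"
    by (intro continuous_intros)
  then obtain p where p: "p \<in> S" "\<And>q. q \<in> S \<Longrightarrow> fst q \<bullet> snd q \<le> fst p \<bullet> snd p"
    using continuous_attains_sup[OF \<open>compact S\<close> \<open>S \<noteq> {}\<close>] by blast
  obtain x v where xv: "p = (x, v)"
    by fastforce
  have x: "x \<in> M" "norm x = 1" and v: "v \<in> C" "norm v = 1"
    using p(1) by (auto simp: xv S_def)
  have max: "y \<bullet> u \<le> x \<bullet> v" if "y \<in> M" "norm y = 1" "u \<in> C" "norm u = 1" for y u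
    using p(2)[of "(y, u)"] that by (simp add: xv S_def)
  have nonneg: "0 \<le> x \<bullet> v"
    using max[of "- x" v] x v M by (simp add: subspace_neg)
  have "y \<bullet> u \<le> (x \<bullet> v) * (norm y * norm u)" if "y \<in> M" "u \<in> C" for y u
  proof (cases "y = 0 \<or> u = 0")
    case False
    then have "(inverse (norm y) *\<^sub>R y) \<bullet> (inverse (norm u) *\<^sub>R u) \<le> x \<bullet> v"
      using that M C(2) by (intro max) (auto simp: subspace_scale)
    then show ?thesis
      using False by (simp add: field_simps)
  qed auto
  with x v nonneg show ?thesis
    by blast
qed

lemma sqrt_one_minus_square_le_norm_diff:
  fixes u y :: "'a::real_inner"
  assumes "norm u = 1" "y \<bullet> u \<le> c * norm y"
  shows "sqrt (1 - c\<^sup>2) \<le> norm (u - y)"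
proof (rule real_le_lsqrt)
  have "(norm (u - y))\<^sup>2 = 1 - 2 * (y \<bullet> u) + (norm y)\<^sup>2"
    using assms(1)
    by (simp add: power2_norm_eq_inner inner_diff inner_commute norm_eq_1)
  \<comment> \<open>Completing the square: with \<open>t = norm y\<close>, the lower bound
    \<open>1 - 2 * c * t + t\<^sup>2\<close> equals
    \<open>1 - c\<^sup>2 + (t - c)\<^sup>2\<close>.\<close>
  moreover have "0 \<le> (norm y - c)\<^sup>2"
    by simp
  ultimately show "1 - c\<^sup>2 \<le> (norm (u - y))\<^sup>2"
    using assms(2) by (simp add: power2_diff mult.commute)
qed auto

theorem proposition1:
  fixes N :: "'a::euclidean_space \<Rightarrow> real"
    and K L :: "'a set"
  assumes "is_norm N"
    and "regular_cone K"
    and "subspace L"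
    and "N = norm"
  shows "nu N K L = sin (angle_subspace_cone (L\<^sup>\<bottom>) (dual_cone K))"
proof -
  let ?M = "L\<^sup>\<bottom>" and ?C = "dual_cone K"
  obtain w where w: "w \<in> ?C" "norm w = 1"
    using regular_cone_dual_nontrivial assms by blast
  then have C: "?C \<noteq> {0}"
    by (metis norm_zero singletonD zero_neq_one)
  show ?thesis
  proof (cases "?M = {0}")
    case True
    then show ?thesis
      using nu_norm_trivial w assms by (simp add: angle_subspace_cone_def)
  next
    case False
    obtain x v where x: "x \<in> ?M" "norm x = 1" and v: "v \<in> ?C" "norm v = 1"
      and nonneg: "0 \<le> x \<bullet> v"
      and max: "\<And>y u. y \<in> ?M \<Longrightarrow> u \<in> ?C \<Longrightarrow> y \<bullet> u \<le> (x \<bullet> v) * (norm y * norm u)"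
      using maximal_unit_inner[OF subspace_orthogonal_comp False closed_dual_cone
          scaleR_in_dual_cone bexI[of "\<lambda>v. norm v = 1", OF w(2,1)]]
      by blast
    define c where "c = x \<bullet> v"
    have c: "0 \<le> c" "c \<le> 1"
      using nonneg norm_cauchy_schwarz[of x v] x v by (auto simp: c_def)
    \<comment> \<open>Since \<open>arccos\<close> is decreasing, the pair with the largest cosine
      attains the smallest angle.\<close>
    have "(LEAST t. \<exists>y u. y \<in> ?M - {0} \<and> u \<in> ?C - {0} \<and> t = vec_angle y u) = arccos c"
    proof (rule Least_equality)
      have "vec_angle x v = arccos c"
        using x v by (simp add: vec_angle_def c_def)
      moreover have "x \<in> ?M - {0}" "v \<in> ?C - {0}"
        using x v by auto
      ultimately show "\<exists>y u. y \<in> ?M - {0} \<and> u \<in> ?C - {0} \<and> arccos c = vec_angle y u"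
        by metis
    next
      fix t
      assume "\<exists>y u. y \<in> ?M - {0} \<and> u \<in> ?C - {0} \<and> t = vec_angle y u"
      then obtain y u where yu: "y \<in> ?M" "y \<noteq> 0" "u \<in> ?C" "u \<noteq> 0" "t = vec_angle y u"
        by blast
      have "y \<bullet> u / (norm y * norm u) \<le> c"
        using max[OF yu(1,3)] yu by (simp add: c_def divide_le_eq)
      \<comment> \<open>The monotonicity of \<open>arccos\<close> holds on [-1, 1] only, so the
        smaller cosine must be shown to be at least -1.\<close>
      moreover have "- 1 \<le> y \<bullet> u / (norm y * norm u)"
        using Cauchy_Schwarz_ineq2[of y u] yu by (simp add: le_divide_eq)
      ultimately show "arccos c \<le> t"
        using c unfolding yu(5) vec_angle_def by (intro arccos_le_arccos) auto
    qed
    then have "sin (angle_subspace_cone ?M ?C) = sqrt (1 - c\<^sup>2)"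
      using c False C by (simp add: angle_subspace_cone_def sin_arccos)
    moreover have "nu norm K L = sqrt (1 - c\<^sup>2)"
      unfolding nu_def dual_norm_norm
    proof (rule Least_equality)
      \<comment> \<open>The vector \<open>c *\<^sub>R x\<close> is the orthogonal projection of
        \<open>v\<close> onto the line spanned by \<open>x\<close>, so this is the Pythagorean
        theorem.\<close>
      have "(norm (v - c *\<^sub>R x))\<^sup>2 = 1 - c\<^sup>2"
        using x v unfolding power2_norm_eq_inner
        by (simp add: inner_diff inner_commute norm_eq_1 c_def power2_eq_square)
      then have "sqrt (1 - c\<^sup>2) = norm (v - c *\<^sub>R x)"
        by (metis norm_ge_zero real_sqrt_abs abs_of_nonneg)
      then show "\<exists>u y. u \<in> ?C \<and> y \<in> ?M \<and> norm u = 1 \<and> sqrt (1 - c\<^sup>2) = norm (u - y)"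
        using x v by (metis subspace_orthogonal_comp subspace_scale)
    next
      fix r
      assume "\<exists>u y. u \<in> ?C \<and> y \<in> ?M \<and> norm u = 1 \<and> r = norm (u - y)"
      then obtain u y where uy: "u \<in> ?C" "y \<in> ?M" "norm u = 1" "r = norm (u - y)"
        by blast
      then show "sqrt (1 - c\<^sup>2) \<le> r"
        using sqrt_one_minus_square_le_norm_diff[of u y c] max[of y u] by (simp add: c_def)
    qed
    ultimately show ?thesis
      using assms by simp
  qed
qed

end
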